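(* For every finite set $\Pi$ of proposition symbols and every $\Pi$-program $\Lambda$ of $\mathrm{MSC}$, there exists an equivalent $\Pi$-program of $\mathrm{MSC}[1]$. The size of the $\mathrm{MSC}[1]$-program is $\mathcal{O}(|\Lambda|)$ and its computation time is $\mathcal{O}(\max(1,\mathrm{md}(\Lambda)))$ times the computation time of $\Lambda$.
   Context: A Kripke model over a finite set $\Pi$ of proposition symbols is $M=(W,R,V)$ with $W\ne\emptyset$, $R\subseteq W\times W$, $V:\Pi\to\mathcal P(W)$. Sequences: a sequence $(\overline b_n)_n$ of $k$-bit strings with attention and print positions $A,P\subseteq[k]$ accepts in round $n$ if some position of $A$ in $\overline b_n$ is $1$ and all positions of $A$ in $\overline b_m$, $m<n$, are $0$; it then outputs the substring of $\overline b_n$ at positions $P$. MSC: $\mathrm{ML}(\Pi)$-formulas: $\varphi::=\top\mid p\mid\neg\varphi\mid(\varphi\wedge\varphi)\mid\Diamond\varphi$ ($p\in\Pi$), with $\Diamond\varphi$ true at $w$ iff true at some $R$-successor. Schemata additionally allow schema variables. A $\Pi$-program of MSC has distinct head predicates $Y_1,\dots,Y_k$ (fixed order), terminal clauses $Y_i(0):=\varphi_i$ with $\varphi_i\in\mathrm{ML}(\Pi)$, iteration clauses $Y_i:=\psi_i$ with $\psi_i$ a schema over $\{Y_1,\dots,Y_k\}$, and sets of attention and print predicates among the heads. $Y_i^0=\varphi_i$; $Y_i^{n+1}$ is $\psi_i$ with each $Y_j$ replaced by $Y_j^n$. The round-$n$ configuration at $w$ is the $k$-bit string whose $i$th bit is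 $1$ iff $(M,w)\models Y_i^n$; $w$ accepts/outputs in round $n$ if this sequence does so w.r.t. positions of attention/print predicates; that output round is the computation time. Size $|\Lambda|$ = number of occurrences of proposition symbols, head predicates, $\top,\neg,\wedge,\Diamond$. $\mathrm{md}(\Lambda)$ is the maximum nesting depth of $\Diamond$ in bodies of terminal and iteration clauses. A program of $\mathrm{MSC}[1]$ is a program of MSC whose terminal clause bodies have modal depth $0$ and whose iteration clause bodies have modal depth at most $1$. Two programs are equivalent if on every Kripke model interpreting their symbols, at every node they produce the same output or neither produces any output.
   Formalization: A computation time of 0 is counted as 1 in the time bound (the literal bound fails for output in round 0, e.g. terminal clause ◇p); Kripke models have worlds in one arbitrary fixed type, and countable worlds suffice for all models. *)

theory Defs
  imports "HOL-Library.Countable_Set"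
begin

text \<open>Modal formulas over atoms of type \<open>'a\<close>; \<open>set_fm \<phi>\<close> is the set of atoms occurring in
  \<open>\<phi>\<close>. Formulas of \<open>ML(\<Pi>)\<close> are the \<open>\<phi> :: 'p fm\<close> with \<open>set_fm \<phi> \<subseteq> \<Pi>\<close>. In schemata, an atom is
  a proposition symbol or a schema variable; the head predicates \<open>Y\<^sub>1, \<dots>, Y\<^sub>k\<close> of a program
  are \<open>Head 0, \<dots>, Head (k - 1)\<close>.\<close>

datatype (set_fm: 'a) fm =
    Truth
  | Atom 'a
  | Neg "'a fm"
  | Conj "'a fm" "'a fm"
  | Dia "'a fm"
  for map: map_fm

datatype 'p symbol = Prop 'p | Head nat

type_synonym 'p schema = "'p symbol fm"

primrec fm_size :: "'a fm \<Rightarrow> nat" where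
  "fm_size Truth = 1"
| "fm_size (Atom a) = 1"
| "fm_size (Neg \<phi>) = 1 + fm_size \<phi>"
| "fm_size (Conj \<phi> \<psi>) = 1 + fm_size \<phi> + fm_size \<psi>"
| "fm_size (Dia \<phi>) = 1 + fm_size \<phi>"

primrec modal_depth :: "'a fm \<Rightarrow> nat" where
  "modal_depth Truth = 0"
| "modal_depth (Atom a) = 0"
| "modal_depth (Neg \<phi>) = modal_depth \<phi>"
| "modal_depth (Conj \<phi> \<psi>) = max (modal_depth \<phi>) (modal_depth \<psi>)"
| "modal_depth (Dia \<phi>) = Suc (modal_depth \<phi>)"

record ('p, 'w) kripke =
  worlds :: "'w set"
  rel :: "('w \<times> 'w) set"
  val :: "'p \<Rightarrow> 'w set"

text \<open>The values of \<open>val M\<close> outside \<open>\<Pi>\<close> are irrelevant and left unconstrained.\<close>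

definition kripke_model :: "'p set \<Rightarrow> ('p, 'w) kripke \<Rightarrow> bool" where
  "kripke_model \<Pi> M \<longleftrightarrow>
     worlds M \<noteq> {} \<and> rel M \<subseteq> worlds M \<times> worlds M \<and> (\<forall>p\<in>\<Pi>. val M p \<subseteq> worlds M)"

primrec sat :: "('p, 'w) kripke \<Rightarrow> 'w \<Rightarrow> 'p fm \<Rightarrow> bool" where
  "sat M w Truth \<longleftrightarrow> True"
| "sat M w (Atom p) \<longleftrightarrow> w \<in> val M p"
| "sat M w (Neg \<phi>) \<longleftrightarrow> \<not> sat M w \<phi>"
| "sat M w (Conj \<phi> \<psi>) \<longleftrightarrow> sat M w \<phi> \<and> sat M w \<psi>"
| "sat M w (Dia \<phi>) \<longleftrightarrow> (\<exists>v. (w, v) \<in> rel M \<and> sat M v \<phi>)"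

text \<open>Positions in bit strings are counted from 0.\<close>

definition seq_accepts_in :: "nat set \<Rightarrow> (nat \<Rightarrow> bool list) \<Rightarrow> nat \<Rightarrow> bool" where
  "seq_accepts_in A b n \<longleftrightarrow> (\<exists>i\<in>A. b n ! i) \<and> (\<forall>m<n. \<forall>i\<in>A. \<not> b m ! i)"

definition seq_output :: "nat set \<Rightarrow> nat set \<Rightarrow> (nat \<Rightarrow> bool list) \<Rightarrow> bool list option" where
  "seq_output A P b =
     (if \<exists>n. seq_accepts_in A b n then Some (nths (b (THE n. seq_accepts_in A b n)) P) else None)"

text \<open>The \<open>i\<close>-th entry of \<open>clauses\<close> consists of the bodies of the terminal and the iteration clause
  of the \<open>i\<close>-th head predicate.\<close>

record 'p msc =
  clauses :: "('p fm \<times> 'p schema) list"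
  attention :: "nat set"
  print_preds :: "nat set"

definition num_heads :: "'p msc \<Rightarrow> nat" where
  "num_heads \<Lambda> = length (clauses \<Lambda>)"

definition msc_program :: "'p set \<Rightarrow> 'p msc \<Rightarrow> bool" where
  "msc_program \<Pi> \<Lambda> \<longleftrightarrow>
     (\<forall>(\<phi>, \<psi>) \<in> set (clauses \<Lambda>).
        set_fm \<phi> \<subseteq> \<Pi> \<and> set_fm \<psi> \<subseteq> Prop ` \<Pi> \<union> Head ` {..<num_heads \<Lambda>}) \<and>
     attention \<Lambda> \<subseteq> {..<num_heads \<Lambda>} \<and> print_preds \<Lambda> \<subseteq> {..<num_heads \<Lambda>}"

definition msc1_program :: "'p set \<Rightarrow> 'p msc \<Rightarrow> bool" where
  "msc1_program \<Pi> \<Lambda> \<longleftrightarrow>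
     msc_program \<Pi> \<Lambda> \<and>
     (\<forall>(\<phi>, \<psi>) \<in> set (clauses \<Lambda>). modal_depth \<phi> = 0 \<and> modal_depth \<psi> \<le> 1)"

primrec inst :: "(nat \<Rightarrow> 'p fm) \<Rightarrow> 'p schema \<Rightarrow> 'p fm" where
  "inst \<sigma> Truth = Truth"
| "inst \<sigma> (Atom s) = (case s of Prop p \<Rightarrow> Atom p | Head i \<Rightarrow> \<sigma> i)"
| "inst \<sigma> (Neg \<psi>) = Neg (inst \<sigma> \<psi>)"
| "inst \<sigma> (Conj \<psi> \<chi>) = Conj (inst \<sigma> \<psi>) (inst \<sigma> \<chi>)"
| "inst \<sigma> (Dia \<psi>) = Dia (inst \<sigma> \<psi>)"

text \<open>\<open>iter_fm \<Lambda> n i\<close> is the formula \<open>Y\<^sub>i\<close> of round \<open>n\<close>.\<close>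

primrec iter_fm :: "'p msc \<Rightarrow> nat \<Rightarrow> nat \<Rightarrow> 'p fm" where
  "iter_fm \<Lambda> 0 = (\<lambda>i. fst (clauses \<Lambda> ! i))"
| "iter_fm \<Lambda> (Suc n) = (\<lambda>i. inst (iter_fm \<Lambda> n) (snd (clauses \<Lambda> ! i)))"

definition configuration :: "'p msc \<Rightarrow> ('p, 'w) kripke \<Rightarrow> 'w \<Rightarrow> nat \<Rightarrow> bool list" where
  "configuration \<Lambda> M w n = map (\<lambda>i. sat M w (iter_fm \<Lambda> n i)) [0..<num_heads \<Lambda>]"

definition accepts_in :: "'p msc \<Rightarrow> ('p, 'w) kripke \<Rightarrow> 'w \<Rightarrow> nat \<Rightarrow> bool" where
  "accepts_in \<Lambda> M w n \<longleftrightarrow> seq_accepts_in (attention \<Lambda>) (configuration \<Lambda> M w) n"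

definition msc_output :: "'p msc \<Rightarrow> ('p, 'w) kripke \<Rightarrow> 'w \<Rightarrow> bool list option" where
  "msc_output \<Lambda> M w = seq_output (attention \<Lambda>) (print_preds \<Lambda>) (configuration \<Lambda> M w)"

text \<open>Each head predicate additionally occurs once as the head of its terminal clause and once as
  the head of its iteration clause.\<close>

definition msc_size :: "'p msc \<Rightarrow> nat" where
  "msc_size \<Lambda> = (\<Sum>(\<phi>, \<psi>) \<leftarrow> clauses \<Lambda>. (1 + fm_size \<phi>) + (1 + fm_size \<psi>))"

text \<open>Inserting 0 only matters for the program without clauses.\<close>

definition msc_modal_depth :: "'p msc \<Rightarrow> nat" where
  "msc_modal_depth \<Lambda> =
     Max (insert 0 (\<Union>(\<phi>, \<psi>) \<in> set (clauses \<Lambda>). {modal_depth \<phi>, modal_depth \<psi>}))"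

text \<open>HOL cannot quantify over the type of worlds inside a formula, so the type is a parameter.
  By \<open>countable_model\<close> below, the type \<open>nat\<close> already yields equivalence over every type of
  worlds.\<close>

definition equivalent :: "'w itself \<Rightarrow> 'p set \<Rightarrow> 'p msc \<Rightarrow> 'p msc \<Rightarrow> bool" where
  "equivalent _ \<Pi> \<Lambda> \<Lambda>' \<longleftrightarrow>
     (\<forall>(M :: ('p, 'w) kripke) w. kripke_model \<Pi> M \<longrightarrow> w \<in> worlds M \<longrightarrow>
        msc_output \<Lambda> M w = msc_output \<Lambda>' M w)"

instance fm :: (countable) countable
  by countable_datatype

lemma countable_formulas:
  assumes "countable \<Pi>"
  shows "countable {\<phi>. set_fm \<phi> \<subseteq> \<Pi>}"
proof -
  have "\<phi> \<in> range (map_fm (from_nat_into \<Pi>))" if "set_fm \<phi> \<subseteq> \<Pi>" for \<phi>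
  proof -
    have "map_fm (from_nat_into \<Pi>) (map_fm (to_nat_on \<Pi>) \<phi>) = map_fm id \<phi>"
      unfolding fm.map_comp
      by (rule fm.map_cong0) (use that assms in auto)
    then show ?thesis
      by (metis fm.map_id rangeI)
  qed
  then have "{\<phi>. set_fm \<phi> \<subseteq> \<Pi>} \<subseteq> range (map_fm (from_nat_into \<Pi>))"
    by blast
  then show ?thesis
    by (rule countable_subset) simp
qed

lemma countable_model:
  fixes M :: "('p, 'w) kripke"
  assumes "finite \<Pi>" and M: "kripke_model \<Pi> M" and w: "w \<in> worlds M"
  shows "\<exists>(N :: ('p, nat) kripke) v. kripke_model \<Pi> N \<and> v \<in> worlds N \<and>
           (\<forall>\<phi>. set_fm \<phi> \<subseteq> \<Pi> \<longrightarrow> sat N v \<phi> = sat M w \<phi>)"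
proof -
  define F where "F = {\<phi>. set_fm \<phi> \<subseteq> \<Pi>}"
  have F: "countable F"
    unfolding F_def by (rule countable_formulas) (use assms in \<open>simp add: countable_finite\<close>)
  define s where "s = (\<lambda>\<phi> v. if sat M v (Dia \<phi>) then SOME u. (v, u) \<in> rel M \<and> sat M u \<phi> else v)"
  have s: "(v, s \<phi> v) \<in> rel M \<and> sat M (s \<phi> v) \<phi>" if "sat M v (Dia \<phi>)" for v \<phi>
    using someI_ex[of "\<lambda>u. (v, u) \<in> rel M \<and> sat M u \<phi>"] that by (simp add: s_def)
  have sW: "s \<phi> v \<in> worlds M" if "v \<in> worlds M" for \<phi> v
  proof (cases "sat M v (Dia \<phi>)")
    case True
    with s[OF True] M show ?thesis by (auto simp: kripke_model_def)
  next
    case False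
    from that False show ?thesis by (simp add: s_def del: sat.simps)
  qed
  define U where "U = (\<lambda>l. foldr s l w) ` lists F"
  have U: "countable U"
    unfolding U_def using F by (intro countable_image countable_lists)
  have wU: "w \<in> U"
    unfolding U_def by (rule image_eqI[of _ _ "[]"]) auto
  have sU: "s \<phi> v \<in> U" if "v \<in> U" "\<phi> \<in> F" for \<phi> v
    using that unfolding U_def by (auto intro!: image_eqI[of _ _ "\<phi> # _"])
  define e where "e = to_nat_on U"
  have e: "e u = e v \<longleftrightarrow> u = v" if "u \<in> U" "v \<in> U" for u v
    unfolding e_def using U that by simp
  define N :: "('p, nat) kripke" where
    "N = \<lparr>worlds = e ` U, rel = {(e u, e v) |u v. u \<in> U \<and> v \<in> U \<and> (u, v) \<in> rel M},
          val = (\<lambda>p. e ` (val M p \<inter> U))\<rparr>"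
  have N: "kripke_model \<Pi> N"
    using wU by (auto simp: kripke_model_def N_def)
  have "sat N (e u) \<phi> = sat M u \<phi>" if "u \<in> U" "set_fm \<phi> \<subseteq> \<Pi>" for u \<phi>
    using that
  proof (induction \<phi> arbitrary: u)
    case (Atom p)
    then show ?case using e by (auto simp: N_def)
  next
    case (Dia \<phi>)
    have "sat N (e u) (Dia \<phi>) \<longleftrightarrow> (\<exists>v\<in>U. (u, v) \<in> rel M \<and> sat N (e v) \<phi>)"
      using e Dia.prems(1) by (auto simp: N_def)
    also have "\<dots> \<longleftrightarrow> (\<exists>v\<in>U. (u, v) \<in> rel M \<and> sat M v \<phi>)"
      using Dia by auto
    also have "\<dots> \<longleftrightarrow> sat M u (Dia \<phi>)"
      using s[of u \<phi>] sU[of u \<phi>] Dia.prems by (auto simp: F_def)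
    finally show ?case .
  qed auto
  then have "\<forall>\<phi>. set_fm \<phi> \<subseteq> \<Pi> \<longrightarrow> sat N (e w) \<phi> = sat M w \<phi>"
    using wU by blast
  moreover have "e w \<in> worlds N"
    using wU by (simp add: N_def)
  ultimately show ?thesis
    using N by blast
qed

end

theory Submission
  imports Defs
begin

text \<open>Every subschema occurrence \<open>\<diamond>\<chi>\<close> of \<open>\<Lambda>\<close> gets a head predicate of its own that recomputes
  \<open>\<diamond>\<chi>\<close> in every round from the heads of the outermost diamonds in \<open>\<chi>\<close>. If the heads of \<open>\<Lambda>\<close> are
  kept constant, then after \<open>d\<close> rounds all these predicates of modal depth at most \<open>d\<close> are correct.
  A cyclic clock of period \<open>md(\<Lambda>) + 1\<close> therefore lets the heads of \<open>\<Lambda>\<close> change only when all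
  diamonds are correct. The heads start out false, and the first tick of the clock installs the
  terminal clauses, so that round \<open>n\<close> of \<open>\<Lambda>\<close> is simulated in round \<open>(md(\<Lambda>) + 1)(n + 1)\<close>.\<close>

section \<open>The translated program\<close>

primrec dia_bodies :: "'a fm \<Rightarrow> 'a fm list" where
  "dia_bodies Truth = []"
| "dia_bodies (Atom a) = []"
| "dia_bodies (Neg \<phi>) = dia_bodies \<phi>"
| "dia_bodies (Conj \<phi> \<psi>) = dia_bodies \<phi> @ dia_bodies \<psi>"
| "dia_bodies (Dia \<phi>) = \<phi> # dia_bodies \<phi>"

primrec flatten :: "('p schema \<Rightarrow> nat) \<Rightarrow> 'p schema \<Rightarrow> 'p schema" where
  "flatten h Truth = Truth"
| "flatten h (Atom s) = Atom s"
| "flatten h (Neg \<phi>) = Neg (flatten h \<phi>)"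
| "flatten h (Conj \<phi> \<psi>) = Conj (flatten h \<phi>) (flatten h \<psi>)"
| "flatten h (Dia \<phi>) = Atom (Head (h \<phi>))"

text \<open>If-then-else in which each branch occurs only once, so that nesting keeps the size
  linear. Only the condition is doubled, and every condition used below is an atom.\<close>

definition ite :: "'a fm \<Rightarrow> 'a fm \<Rightarrow> 'a fm \<Rightarrow> 'a fm" where
  "ite \<alpha> \<phi> \<psi> = Conj (Neg (Conj \<alpha> (Neg \<phi>))) (Neg (Conj (Neg \<alpha>) (Neg \<psi>)))"

text \<open>Via \<open>map_fm Prop\<close>, terminal bodies become schemata, so one list serves both
  kinds of clauses. Repeated bodies stay in the list, which makes its contribution to the size a sum
  over the clauses.\<close>

definition diamonds :: "'p msc \<Rightarrow> 'p schema list" where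
  "diamonds \<Lambda> =
     concat (map (\<lambda>(\<phi>, \<psi>). dia_bodies (map_fm Prop \<phi>) @ dia_bodies \<psi>) (clauses \<Lambda>))"

text \<open>Keyed by the body: all occurrences of the same diamond are read at the head that belongs
  to its first position in the list.\<close>

definition dia_head :: "'p msc \<Rightarrow> 'p schema \<Rightarrow> nat" where
  "dia_head \<Lambda> \<chi> = num_heads \<Lambda> + length (takeWhile (\<lambda>\<chi>'. \<chi>' \<noteq> \<chi>) (diamonds \<Lambda>))"

definition clock_head :: "'p msc \<Rightarrow> nat \<Rightarrow> nat" where
  "clock_head \<Lambda> j = num_heads \<Lambda> + length (diamonds \<Lambda>) + j"

text \<open>The position right behind the last clock head. The flag stored there tells the first
  tick apart from all later ones.\<close>

definition first_head :: "'p msc \<Rightarrow> nat" where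
  "first_head \<Lambda> = clock_head \<Lambda> (Suc (msc_modal_depth \<Lambda>))"

definition tick :: "'p msc \<Rightarrow> 'p schema" where
  "tick \<Lambda> = Atom (Head (clock_head \<Lambda> (msc_modal_depth \<Lambda>)))"

definition sim_clause :: "'p msc \<Rightarrow> nat \<Rightarrow> 'p fm \<times> 'p schema" where
  "sim_clause \<Lambda> i =
     (Neg Truth,
      ite (tick \<Lambda>)
        (ite (Atom (Head (first_head \<Lambda>)))
          (flatten (dia_head \<Lambda>) (map_fm Prop (fst (clauses \<Lambda> ! i))))
          (flatten (dia_head \<Lambda>) (snd (clauses \<Lambda> ! i))))
        (Atom (Head i)))"

text \<open>\<open>Truth\<close> is a default: \<open>sat_dia_head\<close> speaks only of rounds
  whose residue exceeds the modal depth of \<chi>, hence never of round 0.\<close>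

definition dia_clause :: "'p msc \<Rightarrow> 'p schema \<Rightarrow> 'p fm \<times> 'p schema" where
  "dia_clause \<Lambda> \<chi> = (Truth, Dia (flatten (dia_head \<Lambda>) \<chi>))"

definition clock_clause :: "'p msc \<Rightarrow> nat \<Rightarrow> 'p fm \<times> 'p schema" where
  "clock_clause \<Lambda> j =
     (case j of 0 \<Rightarrow> (Truth, tick \<Lambda>) | Suc i \<Rightarrow> (Neg Truth, Atom (Head (clock_head \<Lambda> i))))"

definition first_clause :: "'p msc \<Rightarrow> 'p fm \<times> 'p schema" where
  "first_clause \<Lambda> = (Truth, Conj (Atom (Head (first_head \<Lambda>))) (Neg (tick \<Lambda>)))"

definition to_msc1 :: "'p msc \<Rightarrow> 'p msc" where
  "to_msc1 \<Lambda> =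
     \<lparr>clauses = map (sim_clause \<Lambda>) [0..<num_heads \<Lambda>] @ map (dia_clause \<Lambda>) (diamonds \<Lambda>) @
        map (clock_clause \<Lambda>) [0..<Suc (msc_modal_depth \<Lambda>)] @ [first_clause \<Lambda>],
      attention = attention \<Lambda>, print_preds = print_preds \<Lambda>\<rparr>"

section \<open>Positions of the heads and their clauses\<close>

lemma num_heads_to_msc1:
  "num_heads (to_msc1 \<Lambda>) = num_heads \<Lambda> + length (diamonds \<Lambda>) + msc_modal_depth \<Lambda> + 2"
  by (simp add: to_msc1_def num_heads_def)

lemma clauses_to_msc1:
  "i < num_heads \<Lambda> \<Longrightarrow> clauses (to_msc1 \<Lambda>) ! i = sim_clause \<Lambda> i"
  "j \<le> msc_modal_depth \<Lambda> \<Longrightarrow> clauses (to_msc1 \<Lambda>) ! clock_head \<Lambda> j = clock_clause \<Lambda> j"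
  "clauses (to_msc1 \<Lambda>) ! first_head \<Lambda> = first_clause \<Lambda>"
  by (simp_all add: to_msc1_def nth_append first_head_def clock_head_def del: upt_Suc)

lemma dia_head_eq:
  assumes "\<chi> \<in> set (diamonds \<Lambda>)"
  obtains j where "dia_head \<Lambda> \<chi> = num_heads \<Lambda> + j" "j < length (diamonds \<Lambda>)" "diamonds \<Lambda> ! j = \<chi>"
proof -
  obtain ys zs where split: "diamonds \<Lambda> = ys @ \<chi> # zs" "\<chi> \<notin> set ys"
    using split_list_first[OF assms] by blast
  then have "takeWhile (\<lambda>\<chi>'. \<chi>' \<noteq> \<chi>) (diamonds \<Lambda>) = ys"
    by (auto simp: takeWhile_append)
  with split show ?thesis
    by (intro that[of "length ys"]) (simp_all add: dia_head_def)
qed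

lemma clauses_to_msc1_dia:
  assumes "\<chi> \<in> set (diamonds \<Lambda>)"
  shows "clauses (to_msc1 \<Lambda>) ! dia_head \<Lambda> \<chi> = dia_clause \<Lambda> \<chi>"
  using assms by (elim dia_head_eq) (simp add: to_msc1_def nth_append del: upt_Suc)

lemma dia_head_less:
  "\<chi> \<in> set (diamonds \<Lambda>) \<Longrightarrow> dia_head \<Lambda> \<chi> < num_heads (to_msc1 \<Lambda>)"
  by (elim dia_head_eq) (simp add: num_heads_to_msc1)

section \<open>Flattened schemata\<close>

lemma sat_inst_ite:
  "sat M w (inst \<sigma> (ite \<alpha> \<phi> \<psi>)) \<longleftrightarrow>
     (if sat M w (inst \<sigma> \<alpha>) then sat M w (inst \<sigma> \<phi>) else sat M w (inst \<sigma> \<psi>))"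
  by (simp add: ite_def)

lemma inst_map_Prop [simp]: "inst \<sigma> (map_fm Prop \<phi>) = \<phi>"
  by (induction \<phi>) auto

lemma modal_depth_map_fm [simp]: "modal_depth (map_fm f \<phi>) = modal_depth \<phi>"
  by (induction \<phi>) auto

lemma fm_size_map_fm [simp]: "fm_size (map_fm f \<phi>) = fm_size \<phi>"
  by (induction \<phi>) auto

lemma modal_depth_flatten [simp]: "modal_depth (flatten h \<phi>) = 0"
  by (induction \<phi>) auto

lemma modal_depth_le_fm_size: "modal_depth \<phi> \<le> fm_size \<phi>"
  by (induction \<phi>) auto

lemma dia_bodies_trans: "\<chi> \<in> set (dia_bodies \<phi>) \<Longrightarrow> set (dia_bodies \<chi>) \<subseteq> set (dia_bodies \<phi>)"
  by (induction \<phi>) auto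

lemma set_fm_dia_bodies: "\<chi> \<in> set (dia_bodies \<phi>) \<Longrightarrow> set_fm \<chi> \<subseteq> set_fm \<phi>"
  by (induction \<phi>) auto

lemma set_fm_flatten:
  "set_fm (flatten h \<phi>) \<subseteq> set_fm \<phi> \<union> Head ` h ` set (dia_bodies \<phi>)"
  by (induction \<phi>) auto

text \<open>The summand 3 accounts for the overhead of the two clauses of each diamond.\<close>

lemma fm_size_flatten:
  "fm_size (flatten h \<phi>) + (\<Sum>\<chi>\<leftarrow>dia_bodies \<phi>. 3 + fm_size (Dia (flatten h \<chi>))) \<le> 5 * fm_size \<phi>"
  by (induction \<phi>) auto

lemma sat_inst_cong:
  assumes "\<And>i v. Head i \<in> set_fm \<phi> \<Longrightarrow> sat M v (\<sigma> i) = sat M v (\<tau> i)"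
  shows "sat M w (inst \<sigma> \<phi>) = sat M w (inst \<tau> \<phi>)"
  using assms by (induction \<phi> arbitrary: w) (auto split: symbol.split)

text \<open>Flattening replaces only the outermost diamonds, and their bodies have smaller modal
  depth than \<phi>. The depth restriction in the premise makes this applicable while only the
  shallow diamond heads are correct.\<close>

lemma sat_inst_flatten:
  assumes "\<And>\<chi>. \<chi> \<in> set (dia_bodies \<phi>) \<Longrightarrow> modal_depth \<chi> < modal_depth \<phi> \<Longrightarrow>
    sat M w (\<sigma> (h \<chi>)) = sat M w (inst \<sigma> (Dia \<chi>))"
  shows "sat M w (inst \<sigma> (flatten h \<phi>)) = sat M w (inst \<sigma> \<phi>)"
  using assms by (induction \<phi>) auto

section \<open>Diamonds and modal depth of a program\<close>

lemma set_diamonds: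
  "set (diamonds \<Lambda>) =
     (\<Union>(\<phi>, \<psi>)\<in>set (clauses \<Lambda>). set (dia_bodies (map_fm Prop \<phi>)) \<union> set (dia_bodies \<psi>))"
  by (simp add: diamonds_def split_def)

lemma dia_bodies_subset_diamonds:
  assumes "(\<phi>, \<psi>) \<in> set (clauses \<Lambda>)"
  shows "set (dia_bodies (map_fm Prop \<phi>)) \<subseteq> set (diamonds \<Lambda>)"
    and "set (dia_bodies \<psi>) \<subseteq> set (diamonds \<Lambda>)"
  unfolding set_diamonds using assms by blast+

lemma diamonds_cases:
  assumes "\<chi> \<in> set (diamonds \<Lambda>)"
  obtains \<phi> \<psi> where "(\<phi>, \<psi>) \<in> set (clauses \<Lambda>)" "\<chi> \<in> set (dia_bodies (map_fm Prop \<phi>))"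
    | \<phi> \<psi> where "(\<phi>, \<psi>) \<in> set (clauses \<Lambda>)" "\<chi> \<in> set (dia_bodies \<psi>)"
  using assms unfolding set_diamonds by blast

text \<open>The clause of a diamond refers to the heads of the diamonds inside its body, so these
  need heads as well.\<close>

lemma diamonds_closed:
  assumes "\<chi> \<in> set (diamonds \<Lambda>)"
  shows "set (dia_bodies \<chi>) \<subseteq> set (diamonds \<Lambda>)"
  using assms
proof (cases rule: diamonds_cases)
  case (1 \<phi> \<psi>)
  then show ?thesis
    by (meson dia_bodies_trans dia_bodies_subset_diamonds(1) subset_trans)
next
  case (2 \<phi> \<psi>)
  then show ?thesis
    by (meson dia_bodies_trans dia_bodies_subset_diamonds(2) subset_trans)
qed

lemma set_fm_diamonds:
  assumes "msc_program \<Pi> \<Lambda>" "\<chi> \<in> set (diamonds \<Lambda>)"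
  shows "set_fm \<chi> \<subseteq> Prop ` \<Pi> \<union> Head ` {..<num_heads \<Lambda>}"
proof -
  have clause: "set_fm (map_fm Prop \<phi>) \<subseteq> Prop ` \<Pi>"
    "set_fm \<psi> \<subseteq> Prop ` \<Pi> \<union> Head ` {..<num_heads \<Lambda>}"
    if "(\<phi>, \<psi>) \<in> set (clauses \<Lambda>)" for \<phi> \<psi>
    using assms(1) that unfolding msc_program_def fm.set_map by blast+
  from assms(2) show ?thesis
  proof (cases rule: diamonds_cases)
    case (1 \<phi> \<psi>)
    with clause(1)[OF 1(1)] set_fm_dia_bodies[OF 1(2)] show ?thesis by blast
  next
    case (2 \<phi> \<psi>)
    with clause(2)[OF 2(1)] set_fm_dia_bodies[OF 2(2)] show ?thesis by blast
  qed
qed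

lemma modal_depth_clauses:
  assumes "(\<phi>, \<psi>) \<in> set (clauses \<Lambda>)"
  shows "modal_depth \<phi> \<le> msc_modal_depth \<Lambda>" and "modal_depth \<psi> \<le> msc_modal_depth \<Lambda>"
  unfolding msc_modal_depth_def using assms by (auto intro!: Max_ge)

text \<open>Bounds the number of clock heads, so that the clock has linear size.\<close>

lemma msc_modal_depth_le_size: "msc_modal_depth \<Lambda> \<le> msc_size \<Lambda>"
proof -
  have "modal_depth \<phi> \<le> msc_size \<Lambda> \<and> modal_depth \<psi> \<le> msc_size \<Lambda>"
    if "(\<phi>, \<psi>) \<in> set (clauses \<Lambda>)" for \<phi> \<psi>
  proof -
    have "(1 + fm_size \<phi>) + (1 + fm_size \<psi>) \<le> msc_size \<Lambda>"
      unfolding msc_size_def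
      by (rule member_le_sum_list, use that in force, simp)
    then show ?thesis
      using modal_depth_le_fm_size[of \<phi>] modal_depth_le_fm_size[of \<psi>] by linarith
  qed
  then show ?thesis
    unfolding msc_modal_depth_def by (subst Max_le_iff) auto
qed

section \<open>Membership in MSC[1] and linear size\<close>

text \<open>Flattening removes every diamond, so a diamond survives only at the root of the
  iteration clause of a diamond head.\<close>

lemma msc1_program_to_msc1:
  assumes "msc_program \<Pi> \<Lambda>"
  shows "msc1_program \<Pi> (to_msc1 \<Lambda>)"
proof -
  let ?S = "Prop ` \<Pi> \<union> Head ` {..<num_heads (to_msc1 \<Lambda>)}"
  have flat: "set_fm (flatten (dia_head \<Lambda>) \<chi>) \<subseteq> ?S"
    if "set_fm \<chi> \<subseteq> Prop ` \<Pi> \<union> Head ` {..<num_heads \<Lambda>}" "set (dia_bodies \<chi>) \<subseteq> set (diamonds \<Lambda>)" for \<chi>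
  proof -
    have "Head ` {..<num_heads \<Lambda>} \<subseteq> Head ` {..<num_heads (to_msc1 \<Lambda>)}"
      by (auto simp: num_heads_to_msc1)
    moreover have "Head ` dia_head \<Lambda> ` set (dia_bodies \<chi>) \<subseteq> Head ` {..<num_heads (to_msc1 \<Lambda>)}"
      using that(2) dia_head_less[of _ \<Lambda>] by auto
    ultimately have "set_fm \<chi> \<union> Head ` dia_head \<Lambda> ` set (dia_bodies \<chi>) \<subseteq> ?S"
      using that(1) by (meson Un_least Un_mono le_supI2 subset_refl subset_trans)
    then show ?thesis
      by (rule subset_trans[OF set_fm_flatten])
  qed
  have tick: "set_fm (tick \<Lambda>) \<subseteq> ?S"
    by (simp add: tick_def clock_head_def num_heads_to_msc1)
  have "set_fm (fst c) \<subseteq> \<Pi> \<and> set_fm (snd c) \<subseteq> ?S \<and>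
      modal_depth (fst c) = 0 \<and> modal_depth (snd c) \<le> 1"
    if c: "c \<in> set (clauses (to_msc1 \<Lambda>))" for c
  proof -
    consider i where "i < num_heads \<Lambda>" "c = sim_clause \<Lambda> i"
      | \<chi> where "\<chi> \<in> set (diamonds \<Lambda>)" "c = dia_clause \<Lambda> \<chi>"
      | j where "j \<le> msc_modal_depth \<Lambda>" "c = clock_clause \<Lambda> j"
      | "c = first_clause \<Lambda>"
      using c by (auto simp: to_msc1_def less_Suc_eq_le simp del: upt_Suc)
    then show ?thesis
    proof cases
      case 1
      obtain \<phi> \<psi> where cl: "clauses \<Lambda> ! i = (\<phi>, \<psi>)"
        by fastforce
      then have mem: "(\<phi>, \<psi>) \<in> set (clauses \<Lambda>)"
        using 1 by (metis num_heads_def nth_mem)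
      then have "set_fm (map_fm Prop \<phi>) \<subseteq> Prop ` \<Pi> \<union> Head ` {..<num_heads \<Lambda>}"
        "set_fm \<psi> \<subseteq> Prop ` \<Pi> \<union> Head ` {..<num_heads \<Lambda>}"
        using assms unfolding msc_program_def fm.set_map by blast+
      then show ?thesis
        using 1 flat dia_bodies_subset_diamonds[OF mem] tick cl
        by (simp add: sim_clause_def ite_def first_head_def clock_head_def num_heads_to_msc1 tick_def)
    next
      case 2
      then show ?thesis
        using flat[of \<chi>] set_fm_diamonds[OF assms] diamonds_closed[of \<chi> \<Lambda>]
        by (simp add: dia_clause_def)
    next
      case 3
      then show ?thesis
        using tick
        by (auto simp: clock_clause_def clock_head_def num_heads_to_msc1 tick_def split: nat.split)
    next
      case 4
      then show ?thesis
        using tick by (simp add: first_clause_def first_head_def clock_head_def num_heads_to_msc1 tick_def)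
    qed
  qed
  moreover have "attention (to_msc1 \<Lambda>) \<subseteq> {..<num_heads (to_msc1 \<Lambda>)}"
    "print_preds (to_msc1 \<Lambda>) \<subseteq> {..<num_heads (to_msc1 \<Lambda>)}"
    using assms by (force simp: msc_program_def to_msc1_def num_heads_def)+
  ultimately show ?thesis
    unfolding msc1_program_def msc_program_def split_def by blast
qed

lemma msc_size_to_msc1:
  fixes \<Lambda> :: "'p msc"
  assumes "clauses \<Lambda> \<noteq> []"
  shows "msc_size (to_msc1 \<Lambda>) \<le> 60 * msc_size \<Lambda>"
proof -
  let ?h = "dia_head \<Lambda>" and ?D = "msc_modal_depth \<Lambda>"
  let ?size = "\<lambda>(\<phi>, \<psi>). (1 + fm_size \<phi>) + (1 + fm_size \<psi>)"
  \<comment> \<open>The constant 25 consists of 10 for each of the two \<open>ite\<close> with its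
    doubled condition, 1 for the branch that holds the value, 2 for \<open>Neg Truth\<close> and 2
    for the occurrences of the head.\<close>
  let ?sim = "\<lambda>(\<phi>, \<psi>). 25 + fm_size (flatten ?h (map_fm Prop \<phi>)) + fm_size (flatten ?h \<psi>)"
  let ?dia = "\<lambda>\<chi>. 3 + fm_size (Dia (flatten ?h \<chi>))"
  have sim: "map (?size \<circ> sim_clause \<Lambda>) [0..<num_heads \<Lambda>] = map ?sim (clauses \<Lambda>)"
    by (rule nth_equalityI)
      (auto simp: num_heads_def sim_clause_def ite_def tick_def case_prod_beta)
  have dia: "sum_list (map (?size \<circ> dia_clause \<Lambda>) (diamonds \<Lambda>)) = sum_list (map ?dia (diamonds \<Lambda>))"
    by (simp add: dia_clause_def o_def numeral_eq_Suc)
  have "?size (clock_clause \<Lambda> j) \<le> 5" for j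
    by (simp add: clock_clause_def tick_def split: nat.split)
  then have "sum_list (map (?size \<circ> clock_clause \<Lambda>) [0..<Suc ?D]) \<le> (\<Sum>j\<leftarrow>[0..<Suc ?D]. 5)"
    by (intro sum_list_mono) auto
  then have clock: "sum_list (map (?size \<circ> clock_clause \<Lambda>) [0..<Suc ?D]) \<le> 5 * Suc ?D"
    by (simp add: sum_list_triv del: upt_Suc)
  have first: "?size (first_clause \<Lambda>) = 7"
    by (simp add: first_clause_def tick_def)
  \<comment> \<open>By \<open>fm_size_flatten\<close>, each clause pays for its own diamonds, so
    induction over an arbitrary clause list works.\<close>
  have "(\<Sum>c\<leftarrow>cs. ?sim c) + sum_list (map ?dia
      (concat (map (\<lambda>(\<phi>, \<psi>). dia_bodies (map_fm Prop \<phi>) @ dia_bodies \<psi>) cs))) \<le>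
      30 * (\<Sum>c\<leftarrow>cs. ?size c)" for cs
  proof (induction cs)
    case (Cons c cs)
    obtain \<phi> \<psi> where "c = (\<phi>, \<psi>)" by fastforce
    with Cons show ?case
      using fm_size_flatten[of ?h "map_fm Prop \<phi>"] fm_size_flatten[of ?h \<psi>] by simp
  qed simp
  from this[of "clauses \<Lambda>"]
  have "sum_list (map ?sim (clauses \<Lambda>)) + sum_list (map ?dia (diamonds \<Lambda>)) \<le> 30 * msc_size \<Lambda>"
    by (simp add: diamonds_def msc_size_def)
  moreover have "msc_size (to_msc1 \<Lambda>) = sum_list (map ?sim (clauses \<Lambda>)) +
      sum_list (map ?dia (diamonds \<Lambda>)) + sum_list (map (?size \<circ> clock_clause \<Lambda>) [0..<Suc ?D]) + 7"
    unfolding msc_size_def to_msc1_def sim[symmetric] dia[symmetric] first[symmetric]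
    by (simp del: upt_Suc)
  moreover have "1 \<le> msc_size \<Lambda>"
    using assms by (cases "clauses \<Lambda>") (auto simp: msc_size_def)
  \<comment> \<open>With \<open>s = msc_size \<Lambda>\<close>, the sum is at most
    \<open>30 * s + 5 * (s + 1) + 7\<close>; since \<open>1 \<le> s\<close>, the additive constants
    are absorbed.\<close>
  ultimately show ?thesis
    using clock msc_modal_depth_le_size[of \<Lambda>] by simp
qed

section \<open>Correctness of the simulation\<close>

text \<open>The clock heads form a ring carrying a single true bit, which starts at position 0 and
  moves one position per round. Their clauses contain no diamond, so all nodes are
  synchronised.\<close>

lemma sat_clock:
  assumes "j \<le> msc_modal_depth \<Lambda>"
  shows "sat M w (iter_fm (to_msc1 \<Lambda>) t (clock_head \<Lambda> j)) \<longleftrightarrow> t mod Suc (msc_modal_depth \<Lambda>) = j"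
  using assms
proof (induction t arbitrary: j)
  case 0
  then show ?case
    by (simp add: clauses_to_msc1 clock_clause_def split: nat.split)
next
  case (Suc t)
  then show ?case
    by (auto simp: clauses_to_msc1 clock_clause_def tick_def mod_Suc split: nat.split)
qed

lemma sat_tick:
  "sat M w (inst (iter_fm (to_msc1 \<Lambda>) t) (tick \<Lambda>)) \<longleftrightarrow>
     t mod Suc (msc_modal_depth \<Lambda>) = msc_modal_depth \<Lambda>"
  by (simp add: tick_def sat_clock)

text \<open>The first tick occurs in round \<open>msc_modal_depth \<Lambda>\<close>. The flag still
  holds in that round, so this tick selects the terminal bodies, and it is false ever after.\<close>

lemma sat_first:
  "sat M w (iter_fm (to_msc1 \<Lambda>) t (first_head \<Lambda>)) \<longleftrightarrow> t \<le> msc_modal_depth \<Lambda>"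
proof (induction t)
  case 0
  then show ?case
    by (simp add: clauses_to_msc1 first_clause_def)
next
  case (Suc t)
  have "t mod Suc (msc_modal_depth \<Lambda>) = t" if "t \<le> msc_modal_depth \<Lambda>"
    using that by simp
  with Suc show ?case
    by (auto simp: clauses_to_msc1 first_clause_def sat_tick)
qed

lemma sat_sim_hold:
  assumes "i < num_heads \<Lambda>" "t mod Suc (msc_modal_depth \<Lambda>) \<noteq> msc_modal_depth \<Lambda>"
  shows "sat M w (iter_fm (to_msc1 \<Lambda>) (Suc t) i) = sat M w (iter_fm (to_msc1 \<Lambda>) t i)"
  using assms by (simp add: clauses_to_msc1 sim_clause_def sat_inst_ite sat_tick)

text \<open>Correctness spreads from shallow to deep diamonds, one level per round: the head of
  \<chi> is computed from diamonds of smaller depth, which were already correct one round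
  earlier.\<close>

lemma sat_dia_head:
  assumes "msc_program \<Pi> \<Lambda>" "\<chi> \<in> set (diamonds \<Lambda>)"
    and "modal_depth \<chi> < t mod Suc (msc_modal_depth \<Lambda>)"
  shows "sat M w (iter_fm (to_msc1 \<Lambda>) t (dia_head \<Lambda> \<chi>)) =
    sat M w (inst (iter_fm (to_msc1 \<Lambda>) t) (Dia \<chi>))"
  using assms(2,3)
proof (induction t arbitrary: \<chi> w)
  case (Suc t)
  let ?\<sigma> = "iter_fm (to_msc1 \<Lambda>)"
  \<comment> \<open>The residue of \<open>Suc t\<close> is positive, so \<open>t\<close> is no tick
    and its residue is exactly one smaller.\<close>
  have t: "t mod Suc (msc_modal_depth \<Lambda>) \<noteq> msc_modal_depth \<Lambda>"
    and depth: "modal_depth \<chi> \<le> t mod Suc (msc_modal_depth \<Lambda>)"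
    using Suc.prems(2) by (auto simp: mod_Suc split: if_splits)
  have "sat M v (inst (?\<sigma> t) (flatten (dia_head \<Lambda>) \<chi>)) = sat M v (inst (?\<sigma> (Suc t)) \<chi>)" for v
  proof -
    have "sat M v (inst (?\<sigma> t) (flatten (dia_head \<Lambda>) \<chi>)) = sat M v (inst (?\<sigma> t) \<chi>)"
      by (rule sat_inst_flatten, rule Suc.IH)
        (use Suc.prems(1) diamonds_closed[of \<chi> \<Lambda>] depth in auto)
    \<comment> \<open>The head was computed from the values of round \<open>t\<close> but must be
      correct for those of round \<open>Suc t\<close>. Without a tick the simulated heads agree in
      both rounds.\<close>
    also have "\<dots> = sat M v (inst (?\<sigma> (Suc t)) \<chi>)"
      by (rule sat_inst_cong, rule sat_sim_hold[OF _ t, symmetric])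
        (use set_fm_diamonds[OF assms(1) Suc.prems(1)] in auto)
    finally show ?thesis .
  qed
  then show ?case
    using Suc.prems(1) by (simp add: clauses_to_msc1_dia dia_clause_def)
qed simp

text \<open>At a tick the residue is the full modal depth of the program, which exceeds the depth of
  the body of every outermost diamond in \<phi>.\<close>

lemma sat_flatten_at_tick:
  assumes "msc_program \<Pi> \<Lambda>" "set (dia_bodies \<phi>) \<subseteq> set (diamonds \<Lambda>)"
    and "modal_depth \<phi> \<le> msc_modal_depth \<Lambda>"
    and "t mod Suc (msc_modal_depth \<Lambda>) = msc_modal_depth \<Lambda>"
  shows "sat M w (inst (iter_fm (to_msc1 \<Lambda>) t) (flatten (dia_head \<Lambda>) \<phi>)) =
    sat M w (inst (iter_fm (to_msc1 \<Lambda>) t) \<phi>)"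
  by (rule sat_inst_flatten, rule sat_dia_head[OF assms(1)]) (use assms in auto)

lemma sat_sim:
  assumes "msc_program \<Pi> \<Lambda>" "i < num_heads \<Lambda>"
  shows "sat M w (iter_fm (to_msc1 \<Lambda>) t i) \<longleftrightarrow>
    Suc (msc_modal_depth \<Lambda>) \<le> t \<and> sat M w (iter_fm \<Lambda> (t div Suc (msc_modal_depth \<Lambda>) - 1) i)"
  using assms(2)
proof (induction t arbitrary: i w)
  case 0
  then show ?case
    by (simp add: clauses_to_msc1 sim_clause_def)
next
  case (Suc t)
  let ?D = "msc_modal_depth \<Lambda>" and ?\<sigma> = "iter_fm (to_msc1 \<Lambda>) t"
  obtain \<phi> \<psi> where cl: "clauses \<Lambda> ! i = (\<phi>, \<psi>)"
    by fastforce
  then have mem: "(\<phi>, \<psi>) \<in> set (clauses \<Lambda>)"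
    using Suc.prems by (metis num_heads_def nth_mem)
  then have heads: "set_fm \<psi> \<subseteq> Prop ` \<Pi> \<union> Head ` {..<num_heads \<Lambda>}"
    using assms(1) unfolding msc_program_def by blast
  note step = clauses_to_msc1(1)[OF Suc.prems] sim_clause_def sat_inst_ite sat_tick sat_first
  note flat = sat_flatten_at_tick[OF assms(1)] dia_bodies_subset_diamonds[OF mem]
    modal_depth_clauses[OF mem] cl
  \<comment> \<open>No tick, the first tick, a later tick: the simulated heads are held, loaded with
    the terminal clauses, or advanced by one round.\<close>
  consider "t mod Suc ?D \<noteq> ?D" | "t = ?D" | "t mod Suc ?D = ?D" "?D < t"
    by (metis mod_less_eq_dividend nat_less_le)
  then show ?case
  proof cases
    case 1
    then have "Suc t div Suc ?D = t div Suc ?D"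
      by (simp add: div_Suc mod_Suc)
    moreover have "t \<noteq> ?D"
      using 1 by auto
    then have "Suc ?D \<le> Suc t \<longleftrightarrow> Suc ?D \<le> t"
      by linarith
    ultimately show ?thesis
      using sat_sim_hold[OF Suc.prems 1, of M w] Suc.IH[OF Suc.prems] by (simp del: iter_fm.simps)
  next
    case 2
    then show ?thesis
      by (simp add: step flat)
  next
    case 3
    \<comment> \<open>At a later tick \<open>t div Suc ?D\<close> is positive, so the truncated
      subtraction is exact.\<close>
    have "Suc t div Suc ?D - 1 = Suc (t div Suc ?D - 1)"
      using 3 by (simp add: div_Suc mod_Suc Suc_leI div_greater_zero_iff)
    moreover have "sat M w (inst ?\<sigma> \<psi>) =
        sat M w (inst (iter_fm \<Lambda> (t div Suc ?D - 1)) \<psi>)"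
    proof (rule sat_inst_cong)
      fix j v
      assume "Head j \<in> set_fm \<psi>"
      then have "j < num_heads \<Lambda>"
        using heads by auto
      from Suc.IH[OF this] show "sat M v (?\<sigma> j) = sat M v (iter_fm \<Lambda> (t div Suc ?D - 1) j)"
        using 3 by simp
    qed
    ultimately show ?thesis
      using 3 by (simp add: step flat)
  qed
qed

section \<open>Sequences slowed down by a constant factor\<close>

lemma seq_accepts_in_unique:
  assumes "seq_accepts_in A b m" "seq_accepts_in A b n"
  shows "m = n"
  using assms unfolding seq_accepts_in_def by (meson linorder_neqE_nat)

lemma seq_output_eq:
  assumes "seq_accepts_in A b n"
  shows "seq_output A P b = Some (nths (b n) P)"
proof -
  have "(THE n. seq_accepts_in A b n) = n"
    using assms seq_accepts_in_unique by (metis the_equality)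
  with assms show ?thesis
    by (auto simp: seq_output_def)
qed

text \<open>Abstracts from programs: at the positions in \<open>A\<close>, \<open>b'\<close> idles
  for \<open>p\<close> rounds and then shows each string of \<open>b\<close> for \<open>p\<close>
  rounds. The other positions remain free for auxiliary bits.\<close>

context
  fixes A P :: "nat set" and b b' :: "nat \<Rightarrow> bool list" and p :: nat
  assumes p: "0 < p"
    and slow: "\<And>t i. i \<in> A \<Longrightarrow> b' t ! i \<longleftrightarrow> p \<le> t \<and> b (t div p - 1) ! i"
begin

lemma slow_accepts:
  assumes "seq_accepts_in A b n"
  shows "seq_accepts_in A b' (p * (n + 1))"
proof -
  have *: "\<not> b' m ! i" if "m < p * (n + 1)" "i \<in> A" for m i
  proof (cases "p \<le> m")
    case True
    \<comment> \<open>A round between \<open>p\<close> and the claimed one shows a round of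
      \<open>b\<close> before \<open>n\<close>, where all attention bits are 0.\<close>
    have "m div p < n + 1"
      using that p by (simp add: div_less_iff_less_mult mult.commute)
    moreover have "0 < m div p"
      using True p by (simp add: div_greater_zero_iff)
    ultimately have "m div p - 1 < n"
      by simp
    with assms that slow show ?thesis
      by (auto simp: seq_accepts_in_def)
  qed (use that slow in auto)
  have "p * (n + 1) div p - 1 = n"
    using p by (metis add_diff_cancel_right' nonzero_mult_div_cancel_left less_not_refl)
  with assms slow * show ?thesis
    by (auto simp: seq_accepts_in_def)
qed

text \<open>Any attention bit in \<open>b\<close> is enough, since the least round with such a bit
  accepts. The exact round then follows from \<open>slow_accepts\<close> and uniqueness.\<close>

lemma slow_accepts_back:
  assumes "seq_accepts_in A b' t"
  shows "\<exists>n. seq_accepts_in A b n"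
proof -
  obtain i where "i \<in> A" "b (t div p - 1) ! i"
    using assms slow by (auto simp: seq_accepts_in_def)
  then have ex: "\<exists>n. \<exists>i\<in>A. b n ! i"
    by blast
  show ?thesis
    using LeastI_ex[OF ex] not_less_Least[of _ "\<lambda>n. \<exists>i\<in>A. b n ! i"]
    unfolding seq_accepts_in_def by blast
qed

lemma slow_output:
  assumes "\<And>n. nths (b' (p * (n + 1))) P = nths (b n) P"
  shows "seq_output A P b' = seq_output A P b"
proof (cases "\<exists>n. seq_accepts_in A b n")
  case True
  then obtain n where n: "seq_accepts_in A b n" ..
  show ?thesis
    by (simp only: seq_output_eq[OF n] seq_output_eq[OF slow_accepts[OF n]] assms)
next
  case False
  then show ?thesis
    using slow_accepts_back by (auto simp: seq_output_def)
qed

end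

section \<open>Configurations, acceptance and output\<close>

lemma length_configuration [simp]: "length (configuration \<Lambda> M w n) = num_heads \<Lambda>"
  by (simp add: configuration_def)

lemma nth_configuration [simp]:
  "i < num_heads \<Lambda> \<Longrightarrow> configuration \<Lambda> M w n ! i = sat M w (iter_fm \<Lambda> n i)"
  by (simp add: configuration_def)

lemma configuration_to_msc1:
  assumes "msc_program \<Pi> \<Lambda>" "i < num_heads \<Lambda>"
  shows "configuration (to_msc1 \<Lambda>) M w t ! i \<longleftrightarrow> Suc (msc_modal_depth \<Lambda>) \<le> t \<and>
    configuration \<Lambda> M w (t div Suc (msc_modal_depth \<Lambda>) - 1) ! i"
proof -
  have "i < num_heads (to_msc1 \<Lambda>)"
    using assms(2) by (simp add: num_heads_to_msc1)
  with assms show ?thesis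
    by (simp add: sat_sim)
qed

text \<open>The simulated heads come first and all print positions lie among them, so the auxiliary
  bits behind this prefix are cut off by \<open>nths\<close>.\<close>

lemma nths_configuration_to_msc1:
  assumes "msc_program \<Pi> \<Lambda>"
  shows "nths (configuration (to_msc1 \<Lambda>) M w (Suc (msc_modal_depth \<Lambda>) * (n + 1))) (print_preds \<Lambda>) =
    nths (configuration \<Lambda> M w n) (print_preds \<Lambda>)"
proof -
  let ?k = "num_heads \<Lambda>" and ?t = "Suc (msc_modal_depth \<Lambda>) * (n + 1)"
  let ?b = "configuration (to_msc1 \<Lambda>) M w ?t"
  have t: "?t div Suc (msc_modal_depth \<Lambda>) - 1 = n" "Suc (msc_modal_depth \<Lambda>) \<le> ?t"
    by (metis add_diff_cancel_right' nonzero_mult_div_cancel_left nat.distinct(1)) simp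
  have "take ?k ?b = configuration \<Lambda> M w n"
  proof (rule nth_equalityI)
    show "take ?k ?b ! i = configuration \<Lambda> M w n ! i" if "i < length (take ?k ?b)" for i
      using that configuration_to_msc1[OF assms, of i M w ?t] unfolding t(1)
      by (simp del: nth_configuration mult_Suc)
  qed (simp add: num_heads_to_msc1)
  then have "?b = configuration \<Lambda> M w n @ drop ?k ?b"
    by (metis append_take_drop_id)
  moreover have "{j. j + length (configuration \<Lambda> M w n) \<in> print_preds \<Lambda>} = {}"
    using assms by (auto simp: msc_program_def)
  ultimately show ?thesis
    by (metis append_Nil2 nths_append nths_empty)
qed

lemma
  assumes "msc_program \<Pi> \<Lambda>"
  shows accepts_in_to_msc1: "accepts_in \<Lambda> M w n \<Longrightarrow>
      accepts_in (to_msc1 \<Lambda>) M w (Suc (msc_modal_depth \<Lambda>) * (n + 1))"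
    and msc_output_to_msc1: "msc_output (to_msc1 \<Lambda>) M w = msc_output \<Lambda> M w"
proof -
  have eq: "attention (to_msc1 \<Lambda>) = attention \<Lambda>" "print_preds (to_msc1 \<Lambda>) = print_preds \<Lambda>"
    by (simp_all add: to_msc1_def)
  have slow: "configuration (to_msc1 \<Lambda>) M w t ! i \<longleftrightarrow> Suc (msc_modal_depth \<Lambda>) \<le> t \<and>
      configuration \<Lambda> M w (t div Suc (msc_modal_depth \<Lambda>) - 1) ! i" if "i \<in> attention \<Lambda>" for t i
    using that assms by (intro configuration_to_msc1[OF assms]) (auto simp: msc_program_def)
  show "accepts_in \<Lambda> M w n \<Longrightarrow>
      accepts_in (to_msc1 \<Lambda>) M w (Suc (msc_modal_depth \<Lambda>) * (n + 1))"
    unfolding accepts_in_def eq by (rule slow_accepts[OF zero_less_Suc slow])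
  show "msc_output (to_msc1 \<Lambda>) M w = msc_output \<Lambda> M w"
    unfolding msc_output_def eq
    by (rule slow_output[OF zero_less_Suc slow nths_configuration_to_msc1[OF assms]])
qed

theorem theorem4:
  "\<exists>C :: nat. \<forall>(\<Pi> :: 'p set) \<Lambda>. finite \<Pi> \<longrightarrow> msc_program \<Pi> \<Lambda> \<longrightarrow>
     (\<exists>\<Lambda>'. msc1_program \<Pi> \<Lambda>' \<and>
        equivalent TYPE('w) \<Pi> \<Lambda> \<Lambda>' \<and>
        msc_size \<Lambda>' \<le> C * msc_size \<Lambda> \<and>
        (\<forall>(M :: ('p, 'w) kripke) w n n'. kripke_model \<Pi> M \<longrightarrow> w \<in> worlds M \<longrightarrow>
           accepts_in \<Lambda> M w n \<longrightarrow> accepts_in \<Lambda>' M w n' \<longrightarrow>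
           n' \<le> C * max 1 (msc_modal_depth \<Lambda>) * max 1 n))"
proof (intro exI[of _ 60] allI impI)
  fix \<Pi> :: "'p set" and \<Lambda>
  assume prog: "msc_program \<Pi> \<Lambda>"
  let ?D = "msc_modal_depth \<Lambda>"
  show "\<exists>\<Lambda>'. msc1_program \<Pi> \<Lambda>' \<and> equivalent TYPE('w) \<Pi> \<Lambda> \<Lambda>' \<and> msc_size \<Lambda>' \<le> 60 * msc_size \<Lambda> \<and>
    (\<forall>(M :: ('p, 'w) kripke) w n n'. kripke_model \<Pi> M \<longrightarrow> w \<in> worlds M \<longrightarrow>
      accepts_in \<Lambda> M w n \<longrightarrow> accepts_in \<Lambda>' M w n' \<longrightarrow> n' \<le> 60 * max 1 ?D * max 1 n)"
  proof (cases "clauses \<Lambda> = []")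
    case True \<comment> \<open>Here \<open>to_msc1 \<Lambda>\<close> would be too large: \<open>msc_size \<Lambda> = 0\<close>.\<close>
    then have "attention \<Lambda> = {}"
      using prog by (simp add: msc_program_def num_heads_def)
    \<comment> \<open>Nothing ever accepts without attention predicates, so \<Lambda> itself is a
      witness and the time bound is vacuous.\<close>
    then show ?thesis
      using prog True
      by (intro exI[of _ \<Lambda>])
        (simp add: msc1_program_def equivalent_def accepts_in_def seq_accepts_in_def)
  next
    case False
    have "equivalent TYPE('w) \<Pi> \<Lambda> (to_msc1 \<Lambda>)"
      unfolding equivalent_def by (simp add: msc_output_to_msc1[OF prog])
    moreover have "n' \<le> 60 * max 1 ?D * max 1 n"
      if "accepts_in \<Lambda> M w n" "accepts_in (to_msc1 \<Lambda>) M w n'" for M :: "('p, 'w) kripke" and w n n'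
    proof -
      have "n' = Suc ?D * (n + 1)"
        using that(2) accepts_in_to_msc1[OF prog that(1)] unfolding accepts_in_def
        by (rule seq_accepts_in_unique)
      \<comment> \<open>Round 0 of \<Lambda> is simulated only in round \<open>Suc ?D\<close>;
        replacing \<open>n\<close> and \<open>?D\<close> by their maxima with 1 turns both
        successors into factors of 2.\<close>
      also have "\<dots> \<le> (2 * max 1 ?D) * (2 * max 1 n)"
        by (rule mult_le_mono) auto
      also have "\<dots> \<le> 60 * max 1 ?D * max 1 n"
        by simp
      finally show ?thesis .
    qed
    ultimately show ?thesis
      using msc1_program_to_msc1[OF prog] msc_size_to_msc1[OF False]
      by (intro exI[of _ "to_msc1 \<Lambda>"]) auto
  qed
qed

end
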